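(* For every positive integer $N$, there exists a dense subgroup $G$ of the additive group $\mathbb{R}^N$ such that $G\cap V$ is discrete for every real linear subspace $V\subseteq\mathbb{R}^N$ of dimension $N-1$.
   Context: "Discrete" means discrete as a subspace of $\mathbb{R}^N$ with the Euclidean topology; "dense" means dense in $\mathbb{R}^N$. *)

theory Defs
  imports "HOL-Analysis.Analysis" "HOL-Algebra.Group"
begin

definition additive_group :: "'a::ab_group_add monoid" where
  "additive_group = \<lparr>carrier = UNIV, monoid.mult = (+), one = 0\<rparr>"

lemma carrier_additive_group [simp]: "carrier additive_group = UNIV"
  and mult_additive_group [simp]: "x \<otimes>\<^bsub>additive_group\<^esub> y = x + y"
  and one_additive_group [simp]: "\<one>\<^bsub>additive_group\<^esub> = 0"
  by (simp_all add: additive_group_def)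

lemma comm_group_additive_group: "comm_group additive_group"
  by (rule comm_groupI) (auto simp: algebra_simps intro: exI[of _ "- _"])

lemma inv_additive_group [simp]: "inv\<^bsub>additive_group\<^esub> x = - x"
  by (rule group.inv_equality[OF comm_group.axioms(2)[OF comm_group_additive_group]]) auto

lemma subgroup_additive_group_iff:
  "subgroup H additive_group \<longleftrightarrow>
     0 \<in> H \<and> (\<forall>x\<in>H. \<forall>y\<in>H. x + y \<in> H) \<and> (\<forall>x\<in>H. - x \<in> H)"
  by (auto simp: subgroup_def)

end

theory Submission
  imports Defs
begin

text \<open>
  Choose \<open>v\<close> with \<open>1, v\<^sub>1, \<dots>, v\<^sub>N\<close> linearly independent over the rationals and let
  \<open>G = \<int>\<^sup>N + \<int> v\<close>, which is dense by Kronecker's theorem. Let \<open>c \<noteq> 0\<close> be normal to a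
  hyperplane, and let \<open>f\<close> be a \<open>\<rat>\<close>-linear functional from the reals to the rationals that
  does not vanish on all \<open>c\<^sub>i\<close>. If \<open>z = p + l v\<close> lies in \<open>G\<close> and in the hyperplane, then
  applying \<open>f\<close> to \<open>\<Sum>\<^sub>i c\<^sub>i p\<^sub>i + l (c \<bullet> v) = 0\<close> gives \<open>\<Sum>\<^sub>i a\<^sub>i p\<^sub>i + l b = 0\<close> with rational
  \<open>a \<noteq> 0\<close> and \<open>b\<close>, hence \<open>a \<bullet> z = l (a \<bullet> v - b)\<close>, where \<open>a \<bullet> v \<noteq> b\<close>. So if \<open>z\<close> is short
  then \<open>l = 0\<close>, and then \<open>z = p\<close> is a short integer vector, i.e. \<open>z = 0\<close>.
\<close>

definition rat_generic :: "real ^ 'n \<Rightarrow> bool" where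
  "rat_generic v \<longleftrightarrow> (\<forall>(a :: 'n \<Rightarrow> rat) b.
     (\<Sum>i\<in>UNIV. of_rat (a i) * v $ i) + of_rat b = 0 \<longrightarrow> (\<forall>i. a i = 0) \<and> b = 0)"

definition int_span :: "real ^ 'n \<Rightarrow> (real ^ 'n) set" where
  "int_span v = {z. \<exists>(m :: 'n \<Rightarrow> int) k :: int. \<forall>i. z $ i = of_int (m i) + of_int k * v $ i}"

text \<open>Each rational relation with \<open>a\<close> nonzero confines \<open>v\<close> to a
  hyperplane, a null set, and there are only countably many such relations. If \<open>a\<close> is
  zero, the relation itself forces \<open>b = 0\<close>.\<close>

lemma rat_generic_exists: "\<exists>v :: real ^ 'n. rat_generic v"
proof -
  define H where "H = (\<lambda>(a :: 'n \<Rightarrow> rat, b :: rat).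
    {x :: real ^ 'n. (\<chi> i. of_rat (a i)) \<bullet> x = - of_rat b})"
  define I :: "(('n \<Rightarrow> rat) \<times> rat) set" where "I = {(a, b). a \<noteq> (\<lambda>_. 0)}"
  have "negligible (H p)" if "p \<in> I" for p
  proof -
    obtain a b where p: "p = (a, b)" by fastforce
    with that obtain j where "a j \<noteq> 0" by (auto simp: I_def)
    then have "((\<chi> i. of_rat (a i)) :: real ^ 'n) \<noteq> 0"
      by (auto simp: vec_eq_iff)
    then show ?thesis
      unfolding p H_def by (auto intro: negligible_hyperplane)
  qed
  then have "negligible (\<Union> (H ` I))"
    by (intro negligible_countable_Union) auto
  then obtain v where v: "v \<notin> \<Union> (H ` I)"
    using non_negligible_UNIV by (metis UNIV_eq_I)
  have "rat_generic v"
    unfolding rat_generic_def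
  proof (intro allI impI)
    fix a :: "'n \<Rightarrow> rat" and b
    assume eq: "(\<Sum>i\<in>UNIV. of_rat (a i) * v $ i) + of_rat b = 0"
    then have "v \<in> H (a, b)"
      by (simp add: H_def inner_vec_def eq_neg_iff_add_eq_0)
    with v have "a = (\<lambda>_. 0)" by (auto simp: I_def)
    with eq show "(\<forall>i. a i = 0) \<and> b = 0" by simp
  qed
  then show ?thesis ..
qed

text \<open>Over the rationals, \<open>{x}\<close> extends to a Hamel basis of the reals, so a value
  at \<open>x\<close> extends linearly.\<close>

lemma rat_functional_exists:
  fixes x :: real
  assumes "x \<noteq> 0"
  obtains f :: "real \<Rightarrow> rat"
  where "\<And>y z. f (y + z) = f y + f z" "\<And>q y. f (of_rat q * y) = q * f y" "f x = 1"
proof -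
  interpret vector_space_pair "\<lambda>q x. of_rat q * x :: real" "(*) :: rat \<Rightarrow> rat \<Rightarrow> rat"
    by unfold_locales (auto simp: algebra_simps of_rat_add of_rat_mult)
  have "vs1.independent {x}"
    using assms by (simp add: vs1.dependent_single)
  then obtain f where f: "Vector_Spaces.linear (\<lambda>q x. of_rat q * x) (*) f" "f x = 1"
    using linear_independent_extend[of "{x}" "\<lambda>_. 1"] by auto
  interpret f: Vector_Spaces.linear "\<lambda>q x. of_rat q * x" "(*)" f by (fact f(1))
  show thesis
    using that f.add f.scale f(2) by blast
qed

lemma subgroup_int_span: "subgroup (int_span v) additive_group"
  unfolding subgroup_additive_group_iff
proof (intro conjI ballI)
  show "0 \<in> int_span v"
    by (auto simp: int_span_def intro!: exI[of _ "\<lambda>_. 0"] exI[of _ 0])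
next
  fix x y assume "x \<in> int_span v" "y \<in> int_span v"
  then obtain m k m' k' where
    "\<And>i. x $ i = of_int (m i) + of_int k * v $ i"
    "\<And>i. y $ i = of_int (m' i) + of_int k' * v $ i"
    unfolding int_span_def by blast
  then show "x + y \<in> int_span v"
    unfolding int_span_def
    by (auto simp: algebra_simps intro!: exI[of _ "\<lambda>i. m i + m' i"] exI[of _ "k + k'"])
next
  fix x assume "x \<in> int_span v"
  then obtain m k where "\<And>i. x $ i = of_int (m i) + of_int k * v $ i"
    unfolding int_span_def by blast
  then show "- x \<in> int_span v"
    unfolding int_span_def
    by (auto simp: algebra_simps intro!: exI[of _ "\<lambda>i. - m i"] exI[of _ "- k"])
qed

lemma dense_int_span:
  fixes v :: "real ^ 'n"
  assumes "rat_generic v"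
  shows "closure (int_span v) = UNIV"
proof -
  note gen = assms[unfolded rat_generic_def, rule_format]
  define n where "n = CARD('n)"
  obtain h :: "nat \<Rightarrow> 'n" where h: "bij_betw h {..<n} UNIV"
    unfolding n_def by (metis bij_betw_from_nat_into_finite finite_UNIV lessThan_atLeast0 finite)
  \<comment> \<open>Kronecker's theorem in the form used takes \<open>n + 1\<close> independent
    numbers of which the last, \<open>\<theta> n\<close>, is 1.\<close>
  define \<theta> where "\<theta> = (\<lambda>r. if r < n then v $ h r else 1)"
  have v_inj: "v $ i \<noteq> v $ j" if "i \<noteq> j" for i j
  proof
    assume eq: "v $ i = v $ j"
    define a :: "'n \<Rightarrow> rat" where "a = (\<lambda>l. of_bool (l = i) - of_bool (l = j))"
    have "(\<Sum>l\<in>UNIV. of_rat (a l) * v $ l)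
        = (\<Sum>l\<in>UNIV. (if l = i then v $ l else 0) - (if l = j then v $ l else 0))"
      by (intro sum.cong) (auto simp: a_def of_rat_diff)
    also have "\<dots> = 0"
      using eq by (simp add: sum_subtractf)
    finally have "a i = 0" using gen[of a 0] by simp
    with that show False by (simp add: a_def)
  qed
  have v_ne_1: "v $ i \<noteq> 1" for i
    using gen[of "\<lambda>l. if l = i then 1 else 0" "- 1"]
    by (auto simp: if_distrib[of of_rat] if_distrib[of "\<lambda>x. x * _"] of_rat_minus cong: if_cong)
  have inj: "inj_on \<theta> {..n}"
    using v_inj v_ne_1 h unfolding inj_on_def \<theta>_def bij_betw_def
    by (auto simp: le_less) (metis lessThan_iff)
  interpret Z: Modules.module "(\<lambda>r. (*) (real_of_int r))"
    by (simp add: Modules.module.intro distrib_left mult.commute)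
  have indep: "Z.independent (\<theta> ` {..n})"
    unfolding Z.independent_explicit_module
  proof (intro allI impI)
    fix T u w
    assume T: "finite T" "T \<subseteq> \<theta> ` {..n}" and eq: "(\<Sum>x\<in>T. of_int (u x) * x) = 0" and w: "w \<in> T"
    \<comment> \<open>Extending \<open>u\<close> by zero turns a relation on \<open>T\<close> into
      one on all coordinates and 1, to which genericity applies.\<close>
    define u' where "u' = (\<lambda>x. if x \<in> T then u x else 0)"
    have "0 = (\<Sum>x\<in>\<theta> ` {..n}. of_int (u' x) * x)"
      unfolding eq[symmetric] u'_def using T by (intro sum.mono_neutral_cong_left) auto
    also have "\<dots> = (\<Sum>r\<le>n. of_int (u' (\<theta> r)) * \<theta> r)"
      using inj by (simp add: sum.reindex)
    also have "\<dots> = (\<Sum>r<n. of_int (u' (v $ h r)) * v $ h r) + of_int (u' 1)"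
      by (simp add: lessThan_Suc_atMost[symmetric] \<theta>_def)
    also have "(\<Sum>r<n. of_int (u' (v $ h r)) * v $ h r) = (\<Sum>i\<in>UNIV. of_int (u' (v $ i)) * v $ i)"
      by (rule sum.reindex_bij_betw[OF h])
    finally have "(\<forall>i. of_int (u' (v $ i)) = (0::rat)) \<and> of_int (u' 1) = (0::rat)"
      by (intro gen) simp
    then have "u' (\<theta> r) = 0" for r
      by (simp add: \<theta>_def)
    with T w have "u' w = 0" by auto
    with w show "u w = 0" by (simp add: u'_def)
  qed
  have "\<exists>y\<in>int_span v. dist y x < e" if "e > 0" for x e
  proof -
    \<comment> \<open>The Euclidean norm is at most the sum of the \<open>n\<close> coordinate
      errors, hence the tolerance \<open>e / n\<close>.\<close>
    have "e / n > 0" using that by (simp add: n_def)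
    then obtain k m where km: "\<And>r. r < n \<Longrightarrow> \<bar>of_int k * \<theta> r - of_int (m r) - x $ h r\<bar> < e / n"
      using Kronecker_thm_2[OF indep inj, of "e / n" "\<lambda>r. x $ h r"] by (auto simp: \<theta>_def)
    define g where "g = inv_into {..<n} h"
    have g: "g i < n" "h (g i) = i" for i
      using h unfolding g_def bij_betw_def
      by (metis UNIV_I inv_into_into lessThan_iff, metis UNIV_I f_inv_into_f)
    define y where "y = (\<chi> i. of_int k * v $ i - of_int (m (g i)))"
    have "y \<in> int_span v"
      unfolding int_span_def y_def
      by (auto intro!: exI[of _ "\<lambda>i. - m (g i)"] exI[of _ k])
    moreover have "norm (y - x) < e"
    proof -
      have "norm (y - x) \<le> (\<Sum>i\<in>UNIV. \<bar>(y - x) $ i\<bar>)"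
        by (rule norm_le_l1_cart)
      also have "\<dots> < (\<Sum>i\<in>(UNIV :: 'n set). e / n)"
      proof (rule sum_strict_mono)
        fix i show "\<bar>(y - x) $ i\<bar> < e / n"
          using km[OF g(1)[of i]] g[of i] by (simp add: y_def \<theta>_def)
      qed auto
      also have "\<dots> = e" by (simp add: n_def)
      finally show ?thesis .
    qed
    ultimately show ?thesis by (auto simp: dist_norm)
  qed
  then show ?thesis by (auto simp: closure_approachable)
qed

lemma int_span_hyperplane_separated:
  fixes v c :: "real ^ 'n"
  assumes "rat_generic v" and "c \<noteq> 0"
  obtains e where "e > 0" "\<And>z. \<lbrakk>z \<in> int_span v; c \<bullet> z = 0; norm z < e\<rbrakk> \<Longrightarrow> z = 0"
proof -
  from \<open>c \<noteq> 0\<close> obtain j where "c $ j \<noteq> 0" by (auto simp: vec_eq_iff)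
  \<comment> \<open>The normalisation at \<open>c $ j\<close> makes the rational vector
    \<open>a\<close> below nonzero.\<close>
  then obtain f :: "real \<Rightarrow> rat" where
    add: "\<And>y z. f (y + z) = f y + f z" and scale: "\<And>q y. f (of_rat q * y) = q * f y"
    and j: "f (c $ j) = 1"
    using rat_functional_exists by blast
  have scale_int: "f (of_int m * y) = of_int m * f y" for m y
    using scale[of "of_int m" y] by simp
  have f0: "f 0 = 0" using add[of 0 0] by simp
  have f_sum: "f (sum g A) = (\<Sum>i\<in>A. f (g i))" if "finite A" for g and A :: "'n set"
    using that by induction (simp_all add: add f0)
  define a :: "real ^ 'n" where "a = (\<chi> i. of_rat (f (c $ i)))"
  define b :: real where "b = of_rat (f (c \<bullet> v))"
  define d where "d = a \<bullet> v - b"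
  \<comment> \<open>If \<open>d\<close> were 0, genericity would make every \<open>f (c $ i)\<close>
    vanish, against \<open>f (c $ j) = 1\<close>.\<close>
  have "d \<noteq> 0"
    using assms(1)[unfolded rat_generic_def, rule_format, of "\<lambda>i. f (c $ i)" "- f (c \<bullet> v)"] j
    by (auto simp: d_def a_def b_def inner_vec_def of_rat_minus dest: spec[of _ j])
  have "a $ j = 1" by (simp add: a_def j)
  then have "a \<noteq> 0" by auto
  \<comment> \<open>The bound \<open>\<bar>d\<bar> / norm a\<close> forces the integer
    \<open>l\<close> to be 0 by Cauchy-Schwarz; the bound 1 then kills the integer coordinates that
    remain.\<close>
  have "z = 0" if z: "z \<in> int_span v" "c \<bullet> z = 0" "norm z < min 1 (\<bar>d\<bar> / norm a)" for z
  proof -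
    obtain p :: "'n \<Rightarrow> int" and l :: int where z_eq: "\<And>i. z $ i = of_int (p i) + of_int l * v $ i"
      using z(1) unfolding int_span_def by blast
    have inner_z: "w \<bullet> z = (\<Sum>i\<in>UNIV. of_int (p i) * w $ i) + of_int l * (w \<bullet> v)" for w
      by (simp add: inner_vec_def z_eq sum_distrib_left algebra_simps sum.distrib)
    have "0 = f (c \<bullet> z)" by (simp add: z(2) f0)
    also have "\<dots> = (\<Sum>i\<in>UNIV. of_int (p i) * f (c $ i)) + of_int l * f (c \<bullet> v)"
      by (simp add: inner_z add scale_int f_sum)
    finally have "(of_rat 0 :: real) = of_rat \<dots>" by (rule arg_cong)
    then have "(\<Sum>i\<in>UNIV. of_int (p i) * a $ i) + of_int l * b = 0"
      by (simp add: a_def b_def of_rat_add of_rat_mult of_rat_sum)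
    then have "a \<bullet> z = of_int l * d"
      by (simp add: inner_z d_def algebra_simps)
    then have "\<bar>of_int l\<bar> * \<bar>d\<bar> \<le> norm a * norm z"
      using Cauchy_Schwarz_ineq2[of a z] by (simp add: abs_mult)
    also have "\<dots> < \<bar>d\<bar>"
      using z(3) \<open>a \<noteq> 0\<close> by (simp add: field_simps)
    finally have "l = 0"
      using \<open>d \<noteq> 0\<close> by (cases "l = 0") (auto simp: mult_less_cancel_right1)
    have "z $ i = 0" for i
    proof -
      have "\<bar>z $ i\<bar> < 1"
        using component_le_norm_cart[of z i] z(3) by simp
      with z_eq[of i] \<open>l = 0\<close> show ?thesis by simp
    qed
    then show ?thesis by (simp add: vec_eq_iff)
  qed
  with \<open>d \<noteq> 0\<close> \<open>a \<noteq> 0\<close> show thesis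
    by (intro that[of "min 1 (\<bar>d\<bar> / norm a)"]) auto
qed

theorem theorem8:
  shows "\<exists>G :: (real ^ 'n) set.
           subgroup G additive_group \<and> closure G = UNIV \<and>
           (\<forall>V. subspace V \<and> dim V = CARD('n) - 1 \<longrightarrow> discrete (G \<inter> V))"
proof -
  obtain v :: "real ^ 'n" where v: "rat_generic v"
    using rat_generic_exists by blast
  have sub: "x - y \<in> int_span v" if "x \<in> int_span v" "y \<in> int_span v" for x y
    using that subgroup_int_span[of v] unfolding subgroup_additive_group_iff
    by (metis diff_conv_add_uminus)
  have "discrete (int_span v \<inter> V)" if V: "subspace V" "dim V = CARD('n) - 1" for V
  proof -
    \<comment> \<open>\<open>CARD('n)\<close> is positive, so the subtraction is not truncated and
      \<open>V\<close> lies in some hyperplane with normal \<open>c\<close>.\<close>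
    have "dim V < DIM(real ^ 'n)" using V(2) by simp
    then obtain c where c: "c \<noteq> 0" "span V \<subseteq> {x. c \<bullet> x = 0}"
      using lowdim_subset_hyperplane by blast
    obtain e where e: "e > 0"
      "\<And>z. \<lbrakk>z \<in> int_span v; c \<bullet> z = 0; norm z < e\<rbrakk> \<Longrightarrow> z = 0"
      using int_span_hyperplane_separated[OF v c(1)] by blast
    \<comment> \<open>Differences stay in the group and in the hyperplane, so the gap
      \<open>e\<close> around 0 separates any two points.\<close>
    have "uniform_discrete (int_span v \<inter> V)"
    proof (rule uniformI1[OF e(1)])
      fix x y assume xy: "x \<in> int_span v \<inter> V" "y \<in> int_span v \<inter> V" "dist x y < e"
      then have "x - y \<in> span V"
        by (auto intro: span_diff span_base)
      with c(2) xy sub[of x y] e(2)[of "x - y"] show "x = y"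
        by (auto simp: dist_norm)
    qed
    then show ?thesis by (rule uniform_discrete_imp_discrete)
  qed
  with subgroup_int_span dense_int_span[OF v] show ?thesis by blast
qed

end
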